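(* Let $K$ be a field of characteristic $p\neq2,3$. Any polynomial identity of $\Omega$-degree $2$ of the Jacobian algebra $(K[x_1,x_2,x_3],\mathrm{Jac}_3^S)$, considered as an algebra with the single ternary operation $\omega=\mathrm{Jac}_3^S$, $\mathrm{Jac}_3^S(u_1,u_2,u_3)=\det(\partial u_j/\partial x_i)_{1\le i,j\le 3}$, follows from the $3$-Lie identity and the skew-symmetric identity for the $3$-multiplication $\omega$.
   Context: Take $\Omega=\{\omega\}$ with one ternary operation symbol $\omega$ and a set of variables $t_1,t_2,\ldots$. $\Omega$-words are defined recursively: every variable is an $\Omega$-word, and if $a_1,a_2,a_3$ are $\Omega$-words, so is $\omega a_1a_2a_3$ (meaning $\omega(a_1,a_2,a_3)$). The $\Omega$-degree of a word is the number of occurrences of $\omega$ in it. An $\Omega$-polynomial is a $K$-linear combination of $\Omega$-words; it has $\Omega$-degree $2$ if it is a linear combination of words of $\Omega$-degree $2$. An $\Omega$-algebra is a $K$-vector space $U$ with a trilinear map $\omega_U:U^3\to U$. An $\Omega$-polynomial $f$ is an identity of $U$ if $f$ vanishes under all substitutions of elements of $U$ for variables and $\omega_U$ for $\omega$. An identity $f=0$ follows from a set of identities if $f=0$ holds in every $\Omega$-algebra satisfying all identities of the set. The skew-symmetric identity says that $\omega$ is skew-symmetric in its three arguments. The $3$-Lie identity is $$\omega(t_1,t_2,\omega(t_3,t_4,t_5))=\omega(\omega(t_1,t_2,t_3),t_4,t_5)+\omega(t_3,\omega(t_1,t_2,t_4),t_5)+\omega(t_3,t_4,\omega(t_1,t_2,t_5)).$$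 *)

theory Defs
  imports
    "HOL-Analysis.Determinants"
    "HOL-Combinatorics.Permutations"
    "HOL-Computational_Algebra.Polynomial"
    "HOL-Library.Poly_Mapping"
begin

section \<open>Words and polynomials in one ternary operation symbol\<close>

text \<open>The variable \<open>t\<^sub>i\<close> is \<open>Var i\<close>; the index 0 gives one further variable.\<close>

datatype omega_word = Var nat | Omega omega_word omega_word omega_word

primrec omega_degree :: "omega_word \<Rightarrow> nat" where
  "omega_degree (Var i) = 0"
| "omega_degree (Omega a b c) = Suc (omega_degree a + omega_degree b + omega_degree c)"

text \<open>\<open>K\<close>-linear combinations of words are finitely supported functions from words to \<open>K\<close>.\<close>

type_synonym 'k omega_poly = "omega_word \<Rightarrow>\<^sub>0 'k"

text \<open>Neither homogeneity in the single variables nor multilinearity is required, and the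
  zero polynomial qualifies for every \<open>n\<close>.\<close>

definition has_omega_degree :: "'k::zero omega_poly \<Rightarrow> nat \<Rightarrow> bool" where
  "has_omega_degree f n \<longleftrightarrow> (\<forall>w \<in> Poly_Mapping.keys f. omega_degree w = n)"


section \<open>Algebras with a trilinear operation and their identities\<close>

locale omega_algebra = vector_space smul
  for smul :: "'k::field \<Rightarrow> 'u::ab_group_add \<Rightarrow> 'u" +
  fixes \<omega> :: "'u \<Rightarrow> 'u \<Rightarrow> 'u \<Rightarrow> 'u"
  assumes linear_1: "Vector_Spaces.linear smul smul (\<lambda>u. \<omega> u v w)"
    and linear_2: "Vector_Spaces.linear smul smul (\<lambda>u. \<omega> v u w)"
    and linear_3: "Vector_Spaces.linear smul smul (\<lambda>u. \<omega> v w u)"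

primrec eval_word :: "('u \<Rightarrow> 'u \<Rightarrow> 'u \<Rightarrow> 'u) \<Rightarrow> (nat \<Rightarrow> 'u) \<Rightarrow> omega_word \<Rightarrow> 'u" where
  "eval_word \<omega> s (Var i) = s i"
| "eval_word \<omega> s (Omega a b c) = \<omega> (eval_word \<omega> s a) (eval_word \<omega> s b) (eval_word \<omega> s c)"

definition eval_poly ::
  "('k::zero \<Rightarrow> 'u::comm_monoid_add \<Rightarrow> 'u) \<Rightarrow> ('u \<Rightarrow> 'u \<Rightarrow> 'u \<Rightarrow> 'u) \<Rightarrow> (nat \<Rightarrow> 'u) \<Rightarrow>
    'k omega_poly \<Rightarrow> 'u" where
  "eval_poly smul \<omega> s f =
    (\<Sum>w \<in> Poly_Mapping.keys f. smul (Poly_Mapping.lookup f w) (eval_word \<omega> s w))"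

definition is_identity ::
  "('k::zero \<Rightarrow> 'u::comm_monoid_add \<Rightarrow> 'u) \<Rightarrow> ('u \<Rightarrow> 'u \<Rightarrow> 'u \<Rightarrow> 'u) \<Rightarrow> 'k omega_poly \<Rightarrow> bool" where
  "is_identity smul \<omega> f \<longleftrightarrow> (\<forall>s. eval_poly smul \<omega> s f = 0)"

text \<open>HOL cannot quantify over all types inside a formula, so the type of the algebras is a
  parameter. A theorem whose conclusion is \<open>follows_from TYPE('u) f S\<close> with a type variable
  \<open>'u\<close> not occurring in its hypotheses speaks about algebras on arbitrary vector spaces.\<close>

definition follows_from ::
  "'u::ab_group_add itself \<Rightarrow> 'k::field omega_poly \<Rightarrow> 'k omega_poly set \<Rightarrow> bool" where
  "follows_from _ f S \<longleftrightarrow>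
    (\<forall>(smul :: 'k \<Rightarrow> 'u \<Rightarrow> 'u) \<omega>. omega_algebra smul \<omega> \<longrightarrow>
      (\<forall>g \<in> S. is_identity smul \<omega> g) \<longrightarrow> is_identity smul \<omega> f)"


section \<open>The skew-symmetric and the 3-Lie identity\<close>

abbreviation word_poly :: "omega_word \<Rightarrow> 'k::comm_ring_1 omega_poly" where
  "word_poly w \<equiv> Poly_Mapping.single w 1"

definition skew_symmetric_identities :: "'k::comm_ring_1 omega_poly set" where
  "skew_symmetric_identities =
    {word_poly (Omega (Var (\<sigma> 1)) (Var (\<sigma> 2)) (Var (\<sigma> 3)))
       - Poly_Mapping.single (Omega (Var 1) (Var 2) (Var 3)) (of_int (sign \<sigma>))
     | \<sigma>. \<sigma> permutes {1, 2, 3}}"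

definition three_lie_identity :: "'k::comm_ring_1 omega_poly" where
  "three_lie_identity =
    word_poly (Omega (Var 1) (Var 2) (Omega (Var 3) (Var 4) (Var 5)))
    - (word_poly (Omega (Omega (Var 1) (Var 2) (Var 3)) (Var 4) (Var 5))
       + word_poly (Omega (Var 3) (Omega (Var 1) (Var 2) (Var 4)) (Var 5))
       + word_poly (Omega (Var 3) (Var 4) (Omega (Var 1) (Var 2) (Var 5))))"


section \<open>The Jacobian algebra on polynomials in three variables\<close>

text \<open>\<open>K[x\<^sub>1,x\<^sub>2,x\<^sub>3]\<close> is represented as \<open>K[x\<^sub>1][x\<^sub>2][x\<^sub>3]\<close>: the variable of the outermost \<open>poly\<close>
  is \<open>x\<^sub>3\<close>, that of the innermost one is \<open>x\<^sub>1\<close>.\<close>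

type_synonym 'k poly3 = "'k poly poly poly"

definition scale3 :: "'k::comm_semiring_0 \<Rightarrow> 'k poly3 \<Rightarrow> 'k poly3" where
  "scale3 c = smult [:[:c:]:]"

definition d1 :: "'k::field poly3 \<Rightarrow> 'k poly3" where
  "d1 = map_poly (map_poly pderiv)"

definition d2 :: "'k::field poly3 \<Rightarrow> 'k poly3" where
  "d2 = map_poly pderiv"

definition d3 :: "'k::field poly3 \<Rightarrow> 'k poly3" where
  "d3 = pderiv"

definition Jac3 :: "'k::field poly3 \<Rightarrow> 'k poly3 \<Rightarrow> 'k poly3 \<Rightarrow> 'k poly3" where
  "Jac3 u1 u2 u3 = det (vector
     [vector [d1 u1, d1 u2, d1 u3],
      vector [d2 u1, d2 u2, d2 u3],
      vector [d3 u1, d3 u2, d3 u3]] :: 'k poly3 ^ 3 ^ 3)"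

end

theory Submission
  imports Defs
begin

text \<open>
  In a skew-symmetric algebra every word of degree 2 evaluates to a nested product
  \<open>\<omega>(a, b, \<omega>(c, d, e))\<close>. Substituting \<open>\<alpha>\<^sub>i x\<^sub>1 + \<beta>\<^sub>i x\<^sub>2 + \<gamma>\<^sub>i x\<^sub>3\<^sup>2\<close> for \<open>t\<^sub>i\<close> in the Jacobian algebra turns
  it into twice a product of a \<open>2\<times>2\<close> minor of \<open>(\<alpha>, \<beta>)\<close> and a \<open>3\<times>3\<close> minor of \<open>(\<alpha>, \<beta>, \<gamma>)\<close>, so an
  identity of the Jacobian algebra gives a linear relation between its coefficients for every
  choice of \<open>\<alpha>, \<beta>, \<gamma>\<close>, and scaling the variables by 0, 1, -1 separates these relations by
  multidegree. Conversely, within one multidegree, the 3-Lie identity writes all nested products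
  in any algebra as combinations of at most five of them, and the coefficients of these
  combinations are such products of minors, for suitable indicator functions \<open>\<alpha>, \<beta>, \<gamma>\<close>.
\<close>

section \<open>Words of degree two\<close>

primrec leaves :: "omega_word \<Rightarrow> nat multiset" where
  "leaves (Var i) = {#i#}"
| "leaves (Omega a b c) = leaves a + leaves b + leaves c"

text \<open>The disjuncts are the cyclic rotations of the outer arguments. These are even
  permutations, so evaluation involves no sign.\<close>

definition nested :: "omega_word \<Rightarrow> nat \<Rightarrow> nat \<Rightarrow> nat \<Rightarrow> nat \<Rightarrow> nat \<Rightarrow> bool" where
  "nested w a b c d e \<longleftrightarrow>
    w = Omega (Var a) (Var b) (Omega (Var c) (Var d) (Var e)) \<or>
    w = Omega (Omega (Var c) (Var d) (Var e)) (Var a) (Var b) \<or>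
    w = Omega (Var b) (Omega (Var c) (Var d) (Var e)) (Var a)"

lemma omega_degree_0: "omega_degree w = 0 \<Longrightarrow> \<exists>i. w = Var i"
  by (cases w) auto

lemma omega_degree_1: "omega_degree w = Suc 0 \<Longrightarrow> \<exists>i j k. w = Omega (Var i) (Var j) (Var k)"
  by (cases w) (auto dest!: omega_degree_0)

lemma nested_exists:
  assumes "omega_degree w = 2"
  shows "\<exists>a b c d e. nested w a b c d e"
proof -
  from assms obtain x y z where w: "w = Omega x y z"
    and "omega_degree x + omega_degree y + omega_degree z = 1"
    by (cases w) auto
  then consider "omega_degree x = 1" "omega_degree y = 0" "omega_degree z = 0"
    | "omega_degree x = 0" "omega_degree y = 1" "omega_degree z = 0"
    | "omega_degree x = 0" "omega_degree y = 0" "omega_degree z = 1"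
    by linarith
  then show ?thesis
    by cases (auto simp: w nested_def dest!: omega_degree_0 omega_degree_1)
qed

lemma leaves_nested: "nested w a b c d e \<Longrightarrow> leaves w = {#a, b, c, d, e#}"
  by (auto simp: nested_def)

lemma eval_word_nested:
  assumes "\<And>x y z. \<omega> x y z = \<omega> y z x" and "nested w a b c d e"
  shows "eval_word \<omega> s w = \<omega> (s a) (s b) (\<omega> (s c) (s d) (s e))"
proof -
  have "\<omega> z x y = \<omega> x y z" "\<omega> y z x = \<omega> x y z" for x y z
    using assms(1) by metis+
  with assms(2) show ?thesis
    unfolding nested_def by (elim disjE) simp_all
qed


section \<open>Functions alternating in the first two and in the last three arguments\<close>

definition alternating23 ::
  "(nat \<Rightarrow> nat \<Rightarrow> nat \<Rightarrow> nat \<Rightarrow> nat \<Rightarrow> 'b::ab_group_add) \<Rightarrow> bool" where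
  "alternating23 D \<longleftrightarrow> (\<forall>a b c d e.
     D b a c d e = - D a b c d e \<and> D a b d c e = - D a b c d e \<and> D a b c e d = - D a b c d e \<and>
     D a a c d e = 0 \<and> D a b c c d = 0)"

lemma alternating23_zero:
  assumes "alternating23 D" and "a = b \<or> c = d \<or> d = e \<or> c = e"
  shows "D a b c d e = 0"
  using assms unfolding alternating23_def by (metis neg_equal_0_iff_equal)

text \<open>An index can enter the outer pair once and the inner triple once. The bound 2 is what
  makes scaling by 0, 1, -1 sufficient later.\<close>

lemma alternating23_count:
  assumes "alternating23 D" and "D a b c d e \<noteq> 0"
  shows "count {#a, b, c, d, e#} i \<le> 2"
proof -
  have "a \<noteq> b" "c \<noteq> d" "d \<noteq> e" "c \<noteq> e"
    using alternating23_zero[OF assms(1)] assms(2) by blast+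
  then show ?thesis by (auto)
qed

lemma alternating23_diff:
  "alternating23 D \<Longrightarrow> alternating23 D' \<Longrightarrow>
    alternating23 (\<lambda>a b c d e. D a b c d e - D' a b c d e)"
  unfolding alternating23_def by (metis minus_diff_minus diff_self)

lemma alternating23_swaps:
  assumes "alternating23 D"
  shows "D b a c d e = 0 \<longleftrightarrow> D a b c d e = 0"
    and "D a b d c e = 0 \<longleftrightarrow> D a b c d e = 0"
    and "D a b c e d = 0 \<longleftrightarrow> D a b c d e = 0"
  using assms unfolding alternating23_def by (metis neg_equal_0_iff_equal)+

lemma mset5_cases:
  assumes "{#a, b, c, d, e#} = {#p, q, r, s, t#}"
  shows "a = p \<and> {#b, c, d, e#} = {#q, r, s, t#} \<or> a = q \<and> {#b, c, d, e#} = {#p, r, s, t#}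
    \<or> a = r \<and> {#b, c, d, e#} = {#p, q, s, t#} \<or> a = s \<and> {#b, c, d, e#} = {#p, q, r, t#}
    \<or> a = t \<and> {#b, c, d, e#} = {#p, q, r, s#}"
proof -
  have "a \<in># {#p, q, r, s, t#}" unfolding assms[symmetric] by simp
  then have "a = p \<or> a = q \<or> a = r \<or> a = s \<or> a = t" by simp
  moreover have "{#b, c, d, e#} = {#p, q, r, s, t#} - {#a#}"
    unfolding assms[symmetric] by simp
  ultimately show ?thesis by (auto simp: add_mset_commute)
qed

lemma mset3_cases:
  assumes "{#c, d, e#} = {#r, s, t#}"
  shows "c = r \<and> d = s \<and> e = t \<or> c = r \<and> d = t \<and> e = s \<or> c = s \<and> d = r \<and> e = t
    \<or> c = s \<and> d = t \<and> e = r \<or> c = t \<and> d = r \<and> e = s \<or> c = t \<and> d = s \<and> e = r"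
  using assms by (auto simp: add_eq_conv_ex add_mset_eq_single)

lemma mset4_cases:
  assumes "{#b, c, d, e#} = {#q, r, s, t#}"
  shows "b = q \<and> {#c, d, e#} = {#r, s, t#} \<or> b = r \<and> {#c, d, e#} = {#q, s, t#}
    \<or> b = s \<and> {#c, d, e#} = {#q, r, t#} \<or> b = t \<and> {#c, d, e#} = {#q, r, s#}"
proof -
  have "b \<in># {#q, r, s, t#}" unfolding assms[symmetric] by simp
  then have "b = q \<or> b = r \<or> b = s \<or> b = t" by simp
  moreover have "{#c, d, e#} = {#q, r, s, t#} - {#b#}"
    unfolding assms[symmetric] by simp
  ultimately show ?thesis by (auto simp: add_mset_commute)
qed

text \<open>Up to sign, a value depends only on which two of the five entries stand outside, so ten
  checks cover all arrangements, also with repeated entries.\<close>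

lemma alternating23_eq_0I:
  assumes D: "alternating23 D" and m: "{#a, b, c, d, e#} = {#p, q, r, s, t#}"
    and z: "D p q r s t = 0" "D p r q s t = 0" "D p s q r t = 0" "D p t q r s = 0"
      "D q r p s t = 0" "D q s p r t = 0" "D q t p r s = 0"
      "D r s p q t = 0" "D r t p q s = 0" "D s t p q r = 0"
  shows "D a b c d e = 0"
proof -
  have inner: "D x y c d e = 0" if "{#c, d, e#} = {#u, v, w#}" "D x y u v w = 0" for x y u v w
    using mset3_cases[OF that(1)] that(2) alternating23_swaps[OF D] by metis
  have z': "D q p r s t = 0" "D r p q s t = 0" "D s p q r t = 0" "D t p q r s = 0"
      "D r q p s t = 0" "D s q p r t = 0" "D t q p r s = 0"
      "D s r p q t = 0" "D t r p q s = 0" "D t s p q r = 0"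
    using z alternating23_swaps(1)[OF D] by blast+
  have outer: "D x b c d e = 0"
    if "{#b, c, d, e#} = {#u, v, w, y#}"
      "D x u v w y = 0" "D x v u w y = 0" "D x w u v y = 0" "D x y u v w = 0" for x u v w y
    using mset4_cases[OF that(1)] that(2-) inner by metis
  from mset5_cases[OF m] show ?thesis
    by (elim disjE conjE) (simp only:, rule outer, assumption, (rule z z')+)+
qed


section \<open>Test substitutions in the Jacobian algebra\<close>

definition minors :: "(nat \<Rightarrow> 'k::comm_ring_1) \<Rightarrow> (nat \<Rightarrow> 'k) \<Rightarrow> (nat \<Rightarrow> 'k) \<Rightarrow>
    nat \<Rightarrow> nat \<Rightarrow> nat \<Rightarrow> nat \<Rightarrow> nat \<Rightarrow> 'k" where
  "minors \<alpha> \<beta> \<gamma> a b c d e = (\<alpha> a * \<beta> b - \<beta> a * \<alpha> b) *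
    (\<alpha> c * (\<beta> d * \<gamma> e - \<gamma> d * \<beta> e) - \<beta> c * (\<alpha> d * \<gamma> e - \<gamma> d * \<alpha> e)
     + \<gamma> c * (\<alpha> d * \<beta> e - \<beta> d * \<alpha> e))"

lemma alternating23_minors: "alternating23 (minors \<alpha> \<beta> \<gamma>)"
  unfolding alternating23_def minors_def by (intro allI conjI) (simp_all add: algebra_simps)

lemma Jac3_expand:
  "Jac3 u v w = d1 u * (d2 v * d3 w - d2 w * d3 v) - d1 v * (d2 u * d3 w - d2 w * d3 u)
    + d1 w * (d2 u * d3 v - d2 v * d3 u)"
  unfolding Jac3_def det_3 by (simp add: vector_3 algebra_simps)

lemma Jac3_cyclic: "Jac3 u v w = Jac3 v w u"
  unfolding Jac3_expand by (simp add: algebra_simps)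

text \<open>The polynomial \<open>x x\<^sub>1 + y x\<^sub>2 + z x\<^sub>3\<^sup>2\<close>.\<close>

definition test_poly :: "'k::field \<Rightarrow> 'k \<Rightarrow> 'k \<Rightarrow> 'k poly3" where
  "test_poly x y z = [: [: [:0, x:], [:y:] :], 0, [:[:z:]:] :]"

lemma d_test_poly:
  "d1 (test_poly x y z) = [:[:[:x:]:]:]"
  "d2 (test_poly x y z) = [:[:[:y:]:]:]"
  "d3 (test_poly x y z) = [:0, [:[:2 * z:]:]:]"
  by (simp_all add: test_poly_def d1_def d2_def d3_def map_poly_pCons pderiv_pCons)

lemma d_linear:
  "d1 [:0, [:[:z:]:]:] = 0" "d2 [:0, [:[:z:]:]:] = 0" "d3 [:0, [:[:z:]:]:] = [:[:[:z:]:]:]"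
  by (simp_all add: d1_def d2_def d3_def map_poly_pCons pderiv_pCons)

text \<open>The inner Jacobian is \<open>t\<close> times \<open>x\<^sub>3\<close>, and only its
  derivative by \<open>x\<^sub>3\<close> survives outside. The square in the test polynomials keeps
  the inner Jacobian from being a constant, which the outer one would kill.\<close>

lemma Jac3_nested_test_poly:
  defines "s \<equiv> \<lambda>\<alpha> \<beta> \<gamma> i. test_poly (\<alpha> i) (\<beta> i) (\<gamma> i)"
  shows "Jac3 (s \<alpha> \<beta> \<gamma> a) (s \<alpha> \<beta> \<gamma> b) (Jac3 (s \<alpha> \<beta> \<gamma> c) (s \<alpha> \<beta> \<gamma> d) (s \<alpha> \<beta> \<gamma> e))
    = [:[:[:2 * minors \<alpha> \<beta> \<gamma> a b c d e:]:]:]"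
proof -
  define t where "t = 2 * (\<alpha> c * (\<beta> d * \<gamma> e - \<gamma> d * \<beta> e) - \<beta> c * (\<alpha> d * \<gamma> e - \<gamma> d * \<alpha> e)
     + \<gamma> c * (\<alpha> d * \<beta> e - \<beta> d * \<alpha> e))"
  have "Jac3 (s \<alpha> \<beta> \<gamma> c) (s \<alpha> \<beta> \<gamma> d) (s \<alpha> \<beta> \<gamma> e) = [:0, [:[:t:]:]:]"
    unfolding Jac3_expand s_def d_test_poly t_def
    by (simp add: algebra_simps)
  then show ?thesis
    by (simp add: Jac3_expand s_def d_test_poly d_linear minors_def t_def algebra_simps)
qed

lemma sum_minors_eq_0:
  fixes f :: "'k::field omega_poly"
  assumes two: "(2::'k) \<noteq> 0"
    and nested: "\<And>w. w \<in> Poly_Mapping.keys f \<Longrightarrow> nested w (a w) (b w) (c w) (d w) (e w)"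
    and id: "is_identity scale3 Jac3 f"
  shows "(\<Sum>w\<in>Poly_Mapping.keys f.
    Poly_Mapping.lookup f w * minors \<alpha> \<beta> \<gamma> (a w) (b w) (c w) (d w) (e w)) = 0"
proof -
  define s where "s i = test_poly (\<alpha> i) (\<beta> i) (\<gamma> i)" for i
  define m where "m w = minors \<alpha> \<beta> \<gamma> (a w) (b w) (c w) (d w) (e w)" for w
  have "eval_word Jac3 s w = [:[:[:2 * m w:]:]:]" if "w \<in> Poly_Mapping.keys f" for w
    using eval_word_nested[where \<omega> = Jac3 and s = s, OF Jac3_cyclic nested[OF that]]
    by (simp add: s_def m_def Jac3_nested_test_poly)
  then have "eval_poly scale3 Jac3 s f =
      (\<Sum>w\<in>Poly_Mapping.keys f. [:[:[:2 * (Poly_Mapping.lookup f w * m w):]:]:])"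
    unfolding eval_poly_def scale3_def by (intro sum.cong) (simp_all add: ac_simps)
  with id have "0 = (\<Sum>w\<in>Poly_Mapping.keys f. [:[:[:2 * (Poly_Mapping.lookup f w * m w):]:]:])"
    by (simp add: is_identity_def)
  \<comment> \<open>All summands are constants, so comparing constant terms turns the identity into
    a relation over the field.\<close>
  then have "coeff (coeff (coeff 0 0) 0) 0 =
      coeff (coeff (coeff (\<Sum>w\<in>Poly_Mapping.keys f. [:[:[:2 * (Poly_Mapping.lookup f w * m w):]:]:]) 0) 0) 0"
    by simp
  then have "0 = 2 * (\<Sum>w\<in>Poly_Mapping.keys f. Poly_Mapping.lookup f w * m w)"
    by (simp add: coeff_sum sum_distrib_left)
  with two show ?thesis by (simp add: m_def)
qed


section \<open>Separating the multihomogeneous components\<close>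

text \<open>Multiplying \<mu> i by x makes the sum a polynomial in x of degree at most 2 with
  coefficients \<open>E 0\<close>, \<open>E 1\<close>, \<open>E 2\<close>. Its values at 0, 1, -1
  determine these once 2 is invertible, so small finite fields are covered.\<close>

lemma separate_variable:
  fixes k :: "'w \<Rightarrow> 'k::field"
  assumes two: "(2::'k) \<noteq> 0"
    and deg: "\<And>w. w \<in> W \<Longrightarrow> k w \<noteq> 0 \<Longrightarrow> count (c w) i \<le> 2"
    and zero: "\<And>\<mu>. (\<Sum>w\<in>W. k w * prod_mset (image_mset \<mu> (c w))) = 0"
  shows "(\<Sum>w\<in>W. (if count (c w) i = n then k w else 0) * prod_mset (image_mset \<mu> (c w))) = 0"
proof -
  define E where "E n = (\<Sum>w\<in>W. (if count (c w) i = n then k w else 0) *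
    prod_mset (image_mset \<mu> (c w)))" for n
  have scale: "prod_mset (image_mset (\<mu>(i := x * \<mu> i)) M) = x ^ count M i * prod_mset (image_mset \<mu> M)"
    for x M by (induction M) (auto simp: ac_simps)
  have E: "E 0 + x * E 1 + x\<^sup>2 * E 2 = 0" for x
  proof -
    have "E 0 + x * E 1 + x\<^sup>2 * E 2 =
        (\<Sum>w\<in>W. k w * prod_mset (image_mset (\<mu>(i := x * \<mu> i)) (c w)))"
      unfolding E_def sum_distrib_left sum.distrib[symmetric]
    proof (intro sum.cong refl)
      fix w assume "w \<in> W"
      from deg[OF this] consider "k w = 0" | "count (c w) i = 0" | "count (c w) i = 1" | "count (c w) i = 2"
        by linarith
      then show "(if count (c w) i = 0 then k w else 0) * prod_mset (image_mset \<mu> (c w)) +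
         x * ((if count (c w) i = 1 then k w else 0) * prod_mset (image_mset \<mu> (c w))) +
         x\<^sup>2 * ((if count (c w) i = 2 then k w else 0) * prod_mset (image_mset \<mu> (c w))) =
         k w * prod_mset (image_mset (\<mu>(i := x * \<mu> i)) (c w))"
        unfolding scale by cases auto
    qed
    then show ?thesis using zero by simp
  qed
  have E0: "E 0 = 0" using E[of 0] by simp
  have "E 1 + E 2 = 0" "- E 1 + E 2 = 0" using E[of 1] E[of "-1"] E0 by simp_all
  moreover from this have "2 * E 2 = 0" by (simp add: add_eq_0_iff)
  ultimately have E12: "E 1 = 0" "E 2 = 0" using two by auto
  have "E n = 0" if "n > 2"
    unfolding E_def using deg that by (intro sum.neutral) fastforce
  then show ?thesis
    using E0 E12 unfolding E_def[symmetric]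
    by (metis One_nat_def less_2_cases linorder_neqE_nat)
qed

text \<open>Apply \<open>separate_variable\<close> to one variable after another, each time to the
  coefficients filtered so far.\<close>

lemma separate_content:
  fixes k :: "'w \<Rightarrow> 'k::field"
  assumes "(2::'k) \<noteq> 0" and "finite W"
    and "\<And>w i. w \<in> W \<Longrightarrow> k w \<noteq> 0 \<Longrightarrow> count (c w) i \<le> 2"
    and "\<And>\<mu>. (\<Sum>w\<in>W. k w * prod_mset (image_mset \<mu> (c w))) = 0"
  shows "(\<Sum>w | w \<in> W \<and> c w = m. k w) = 0"
proof -
  have *: "(\<Sum>w\<in>W. (if \<forall>i\<in>I. count (c w) i = count m i then k w else 0) *
      prod_mset (image_mset \<mu> (c w))) = 0" if "finite I" for I \<mu>
    using that
  proof (induction I arbitrary: \<mu>)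
    case empty
    then show ?case using assms by simp
  next
    case (insert j I)
    have "(\<Sum>w\<in>W. (if count (c w) j = count m j
          then (if \<forall>i\<in>I. count (c w) i = count m i then k w else 0) else 0) *
        prod_mset (image_mset \<mu> (c w))) = 0"
      by (rule separate_variable) (use assms insert.IH in \<open>auto split: if_splits\<close>)
    then show ?case
      by (rule trans[rotated]) (auto intro!: sum.cong)
  qed
  \<comment> \<open>Outside \<open>I\<close> both multisets have count 0, so agreement on
    \<open>I\<close> is equality.\<close>
  define I where "I = set_mset m \<union> (\<Union>w\<in>W. set_mset (c w))"
  have "finite I" using assms(2) by (auto simp: I_def)
  have eq: "(\<forall>i\<in>I. count (c w) i = count m i) \<longleftrightarrow> c w = m" if "w \<in> W" for w
  proof
    assume *: "\<forall>i\<in>I. count (c w) i = count m i"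
    show "c w = m"
    proof (rule multiset_eqI)
      fix i show "count (c w) i = count m i"
        using * that by (cases "i \<in> I") (auto simp: I_def simp flip: count_eq_zero_iff)
    qed
  qed simp
  have "(\<Sum>w | w \<in> W \<and> c w = m. k w) = (\<Sum>w\<in>W. if c w = m then k w else 0)"
    using assms(2) by (simp add: sum.inter_filter)
  also have "\<dots> = (\<Sum>w\<in>W. (if \<forall>i\<in>I. count (c w) i = count m i then k w else 0) *
      prod_mset (image_mset (\<lambda>_. 1) (c w)))"
    using eq by (intro sum.cong refl) (simp add: prod_mset_constant)
  also have "\<dots> = 0" using *[OF \<open>finite I\<close>] .
  finally show ?thesis .
qed


section \<open>Consequences of the 3-Lie identity\<close>

text \<open>
  For five arguments write \<open>N\<^sub>P\<close> for the nested product with the pair \<open>P\<close> outside, signed so that the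
  arguments form an even permutation. The 3-Lie identity says that \<open>N\<^sub>P\<close> is the sum of the \<open>N\<^sub>Q\<close> over
  the three pairs \<open>Q\<close> disjoint from \<open>P\<close>. Let \<open>T\<close> be the sum of all \<open>N\<^sub>P\<close> and \<open>S\<close> the sum over the
  pairs containing \<open>x\<close>. Summing over all \<open>P\<close> gives \<open>T = 3T\<close>, and summing over the pairs containing
  \<open>x\<close> gives \<open>S = 2(T - S)\<close>, whence \<open>S = 0\<close>.
\<close>

lemma
  fixes B :: "nat \<Rightarrow> nat \<Rightarrow> nat \<Rightarrow> nat \<Rightarrow> nat \<Rightarrow> 'b::ab_group_add"
  assumes alt: "alternating23 B"
    and lie: "\<And>a b c d e. B a b c d e = B d e a b c + B e c a b d + B c d a b e"
    and two_torsion_free: "\<And>v::'b. v + v = 0 \<Longrightarrow> v = 0" and three_torsion_free: "\<And>v::'b. v + v + v = 0 \<Longrightarrow> v = 0"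
  shows lie_star: "B x a b c d - B x b a c d + B x c a b d - B x d a b c = 0"
    and lie_straighten: "B p q r s t = B t r p q s - B s q p r t - B p s q r t"
proof -
  have neg: "B y x u v w = - B x y u v w" "B x y v u w = - B x y u v w"
    "B x y u w v = - B x y u v w" for x y u v w
    using alt unfolding alternating23_def by blast+
  have even: "B x y v w u = B x y u v w" "B x y w u v = B x y u v w"
    "B y x v u w = B x y u v w" "B y x u w v = B x y u v w" "B y x w v u = B x y u v w"
    for x y u v w by (metis neg minus_minus)+
  show star: "B x a b c d - B x b a c d + B x c a b d - B x d a b c = 0" for x a b c d
  proof -
    define xa xb xc xd ab ac ad bc bd cd where
      N: "xa = B x a b c d" "xb = B b x a c d" "xc = B x c a b d" "xd = B d x a b c"
        "ab = B a b x c d" "ac = B c a x b d" "ad = B a d x b c"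
        "bc = B b c x a d" "bd = B d b x a c" "cd = B c d x a b"
    have L: "xa = bc + bd + cd" "xb = ac + ad + cd" "xc = ab + ad + bd" "xd = ab + ac + bc"
      "ab = xc + xd + cd" "ac = xb + xd + bd" "ad = xb + xc + bc"
      "bc = xa + xd + ad" "bd = xa + xc + ac" "cd = xa + xb + ab"
      unfolding N
      by (subst lie, simp only: even ac_simps)+
    define T where "T = xa + xb + xc + xd + ab + ac + ad + bc + bd + cd"
    have "T = (bc + bd + cd) + (ac + ad + cd) + (ab + ad + bd) + (ab + ac + bc)
      + (xc + xd + cd) + (xb + xd + bd) + (xb + xc + bc) + (xa + xd + ad) + (xa + xc + ac) + (xa + xb + ab)"
      unfolding T_def by (intro arg_cong2[where f = "(+)"] L)
    also have "\<dots> = T + (T + T)" unfolding T_def by (simp add: ac_simps)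
    finally have "T + T = 0" by (simp only: add_cancel_right_right)
    then have "T = 0" by (rule two_torsion_free)
    define S where "S = xa + xb + xc + xd"
    have "S = (bc + bd + cd) + (ac + ad + cd) + (ab + ad + bd) + (ab + ac + bc)"
      unfolding S_def by (intro arg_cong2[where f = "(+)"] L)
    also have "\<dots> = (T + T) - (S + S)" unfolding T_def S_def by (simp add: algebra_simps)
    finally have "S + (S + S) = T + T" by (simp only: eq_diff_eq)
    then have "S + S + S = 0" using \<open>T = 0\<close> by (simp add: add.assoc)
    then have "S = 0" by (rule three_torsion_free)
    moreover have "xb = - B x b a c d" "xd = - B x d a b c" unfolding N by (rule neg)+
    ultimately show ?thesis unfolding S_def by (simp add: N algebra_simps)
  qed
  \<comment> \<open>On the pentagon p, q, r, s, t the pair pq is a side. Its 3-Lie expansion has the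
    diagonal rt and the sides st, rs; the star relation at \<open>s\<close> trades these two sides
    for the diagonals sq and ps.\<close>
  have "B s t p q r + B r s p q t = - (B s q p r t + B p s q r t)"
    using star[of s p q r t] neg(1)[of r s p q t] neg(1)[of p s q r t]
    by (simp add: algebra_simps)
  with lie[of p q r s t] show "B p q r s t = B t r p q s - B s q p r t - B p s q r t"
    by (simp add: algebra_simps)
qed


section \<open>Alternating functions as combinations of test values\<close>

text \<open>Scalar tests with vector coefficients. Any function of this shape sums to zero against
  the coefficients of an identity of the Jacobian algebra, within each multidegree.\<close>

definition test_comb :: "('k::comm_ring_1 \<Rightarrow> 'b \<Rightarrow> 'b::ab_group_add) \<Rightarrow>
    (((nat \<Rightarrow> 'k) \<times> (nat \<Rightarrow> 'k) \<times> (nat \<Rightarrow> 'k)) \<times> 'b) list \<Rightarrow>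
    nat \<Rightarrow> nat \<Rightarrow> nat \<Rightarrow> nat \<Rightarrow> nat \<Rightarrow> 'b" where
  "test_comb smul L a b c d e =
    (\<Sum>((\<alpha>, \<beta>, \<gamma>), u)\<leftarrow>L. smul (minors \<alpha> \<beta> \<gamma> a b c d e) u)"

definition mark :: "nat set \<Rightarrow> nat \<Rightarrow> 'k::comm_ring_1" where
  "mark I i = (if i \<in> I then 1 else 0)"

context vector_space
begin

lemma test_comb_simps:
  "test_comb scale [] a b c d e = 0"
  "test_comb scale (((\<alpha>, \<beta>, \<gamma>), u) # L) a b c d e =
    scale (minors \<alpha> \<beta> \<gamma> a b c d e) u + test_comb scale L a b c d e"
  by (simp_all add: test_comb_def)

lemma alternating23_test_comb: "alternating23 (test_comb scale L)"
proof (induction L)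
  case Nil
  then show ?case by (simp add: alternating23_def test_comb_simps)
next
  case (Cons x L)
  obtain \<alpha> \<beta> \<gamma> u where x: "x = ((\<alpha>, \<beta>, \<gamma>), u)" by (metis surj_pair)
  \<comment> \<open>The double minus presents the sum as a difference, so that
    \<open>alternating23_diff\<close> applies.\<close>
  have "alternating23 (\<lambda>a b c d e. scale (minors \<alpha> \<beta> \<gamma> a b c d e) u - - test_comb scale L a b c d e)"
  proof (rule alternating23_diff)
    show "alternating23 (\<lambda>a b c d e. scale (minors \<alpha> \<beta> \<gamma> a b c d e) u)"
      using alternating23_minors[of \<alpha> \<beta> \<gamma>] unfolding alternating23_def
      by (metis scale_minus_left scale_zero_left)
    show "alternating23 (\<lambda>a b c d e. - test_comb scale L a b c d e)"
      using Cons.IH unfolding alternating23_def by (metis neg_equal_0_iff_equal)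
  qed
  moreover have "(\<lambda>a b c d e. scale (minors \<alpha> \<beta> \<gamma> a b c d e) u - - test_comb scale L a b c d e)
      = test_comb scale (x # L)"
    by (intro ext) (simp add: x test_comb_simps)
  ultimately show ?case by simp
qed

lemma test_comb_eqI:
  assumes "alternating23 B" and "{#a, b, c, d, e#} = {#p, q, r, s, t#}"
    and "B p q r s t = test_comb scale L p q r s t" "B p r q s t = test_comb scale L p r q s t"
      "B p s q r t = test_comb scale L p s q r t" "B p t q r s = test_comb scale L p t q r s"
      "B q r p s t = test_comb scale L q r p s t" "B q s p r t = test_comb scale L q s p r t"
      "B q t p r s = test_comb scale L q t p r s" "B r s p q t = test_comb scale L r s p q t"
      "B r t p q s = test_comb scale L r t p q s" "B s t p q r = test_comb scale L s t p q r"
  shows "B a b c d e = test_comb scale L a b c d e"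
proof -
  have "B a b c d e - test_comb scale L a b c d e = 0"
    by (rule alternating23_eq_0I[OF alternating23_diff[OF assms(1) alternating23_test_comb] assms(2)])
      (use assms(3-) in simp_all)
  then show ?thesis by simp
qed

context
  fixes B :: "nat \<Rightarrow> nat \<Rightarrow> nat \<Rightarrow> nat \<Rightarrow> nat \<Rightarrow> 'b"
  assumes alt: "alternating23 B"
    and lie: "\<And>a b c d e. B a b c d e = B d e a b c + B e c a b d + B c d a b e"
    and two: "(2::'a) \<noteq> 0" and three: "(3::'a) \<noteq> 0"
begin

lemma two_torsion_free: "v + v = 0 \<Longrightarrow> v = (0::'b)"
proof -
  assume "v + v = 0"
  moreover have "v + v = scale 2 v" by (metis one_add_one scale_left_distrib scale_one)
  ultimately show "v = 0" using two by simp
qed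

lemma three_torsion_free: "v + v + v = 0 \<Longrightarrow> v = (0::'b)"
proof -
  assume "v + v + v = 0"
  moreover have "v + v + v = scale (1 + 1 + 1) v" by (simp only: scale_left_distrib scale_one)
  ultimately show "v = 0" using three by simp
qed

lemmas nested_star = lie_star[OF alt lie two_torsion_free three_torsion_free]
lemmas nested_straighten = lie_straighten[OF alt lie two_torsion_free three_torsion_free]

lemma nested_neg:
  "B y x u v w = - B x y u v w" "B x y v u w = - B x y u v w" "B x y u w v = - B x y u v w"
  using alt unfolding alternating23_def by blast+

lemma nested_zero: "B x x u v w = 0" "B x y u u v = 0" "B x y u v v = 0" "B x y u v u = 0"
  using alternating23_zero[OF alt] by blast+

text \<open>
  Placing the five variables on a pentagon, the spanning products are those whose outer pair is a
  diagonal. The test for a diagonal is supported on the 4-cycle formed by that diagonal and three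
  sides, so it vanishes on the other four diagonals. The order on the variables only serves to
  normalise signs by sorting arguments.
\<close>

lemma span_distinct:
  assumes "p < q" "q < r" "r < s" "s < t" and "{#a, b, c, d, e#} = {#p, q, r, s, t#}"
  shows "B a b c d e = test_comb scale
    [((mark {p, s}, mark {r, t}, mark {q}), B p r q s t),
     ((mark {q, t}, mark {s, p}, mark {r}), B q s p r t),
     ((mark {r, p}, mark {t, q}, mark {s}), B r t p q s),
     ((mark {s, q}, mark {p, r}, mark {t}), - B p s q r t),
     ((mark {t, r}, mark {q, s}, mark {p}), - B q t p r s)] a b c d e"
proof -
  have sort: "y < x \<Longrightarrow> B x y u v w = - B y x u v w" "v < u \<Longrightarrow> B x y u v w = - B x y v u w"
    "w < v \<Longrightarrow> B x y u v w = - B x y u w v" for x y u v w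
    using nested_neg by blast+
  have less: "p < r" "p < s" "p < t" "q < s" "q < t" "r < t"
    using assms(1-4) by simp_all
  note less = less assms(1-4)
  have neq: "p \<noteq> q" "p \<noteq> r" "p \<noteq> s" "p \<noteq> t" "q \<noteq> r" "q \<noteq> s" "q \<noteq> t" "r \<noteq> s" "r \<noteq> t" "s \<noteq> t"
    using less by simp_all
  note neq = neq neq[symmetric]
  \<comment> \<open>The five sides of the pentagon in terms of its diagonals, by rotating
    \<open>nested_straighten\<close>.\<close>
  have straight: "B p q r s t = B q s p r t - B r t p q s - B p s q r t"
    "B q r p s t = B r t p q s + B p s q r t - B q t p r s"
    "B r s p q t = B q t p r s - B p s q r t + B p r q s t"
    "B s t p q r = B q s p r t - B q t p r s - B p r q s t"
    "B p t q r s = B q s p r t - B p r q s t - B r t p q s"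
    using nested_straighten[of p q r s t] nested_straighten[of q r s t p] nested_straighten[of r s t p q]
      nested_straighten[of s t p q r] nested_straighten[of t p q r s]
    by (simp_all add: sort less algebra_simps)
  \<comment> \<open>With sorted arguments the first three tests are 1 on their own diagonals and the
    last two are -1, which the minus signs on their coefficients compensate.\<close>
  show ?thesis
    by (rule test_comb_eqI[OF alt assms(5)])
      (simp_all add: test_comb_simps minors_def mark_def neq straight)
qed

text \<open>A nonzero value has one \<open>x\<close> in the pair and one in the triple, leaving the
  outer pairs xy, xz, xw. The star relation at \<open>x\<close> eliminates xy.\<close>

lemma span_one_pair:
  assumes "x \<noteq> y" "x \<noteq> z" "x \<noteq> w" "y \<noteq> z" "y \<noteq> w" "z \<noteq> w"
    and "{#a, b, c, d, e#} = {#x, x, y, z, w#}"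
  shows "B a b c d e = test_comb scale
    [((mark {x}, mark {y, z}, mark {w}), B x z x y w),
     ((mark {x}, mark {y, w}, mark {z}), B x w x y z)] a b c d e"
proof -
  have s: "B x y x z w = B x z x y w - B x w x y z"
    using nested_star[of x x y z w] by (simp add: nested_zero algebra_simps)
  show ?thesis
    by (rule test_comb_eqI[OF alt assms(7)])
      (simp_all add: test_comb_simps minors_def mark_def assms(1-6) assms(1-6)[symmetric] nested_zero s)
qed

text \<open>Both \<open>x\<close> and \<open>y\<close> must occur in the pair and in the triple, so
  a single value survives up to sign.\<close>

lemma span_two_pairs:
  assumes "x \<noteq> y" "x \<noteq> z" "y \<noteq> z" and "{#a, b, c, d, e#} = {#x, x, y, y, z#}"
  shows "B a b c d e = test_comb scale
    [((mark {x}, mark {y}, mark {z}), B x y x y z)] a b c d e"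
  by (rule test_comb_eqI[OF alt assms(4)])
    (simp_all add: test_comb_simps minors_def mark_def assms(1-3) assms(1-3)[symmetric] nested_zero)

end

end

context vector_space
begin

text \<open>The list \<open>L\<close> depends on the multiset only, not on the arrangement. After
  sorting, the cases are the patterns of equal neighbours; an entry occurring three times forces
  zero and the empty list.\<close>

lemma test_comb_exists:
  fixes B :: "nat \<Rightarrow> nat \<Rightarrow> nat \<Rightarrow> nat \<Rightarrow> nat \<Rightarrow> 'b"
  assumes alt: "alternating23 B"
    and lie: "\<And>a b c d e. B a b c d e = B d e a b c + B e c a b d + B c d a b e"
    and two: "(2::'a) \<noteq> 0" and three: "(3::'a) \<noteq> 0" and size: "size m = 5"
  shows "\<exists>L. \<forall>a b c d e. {#a, b, c, d, e#} = m \<longrightarrow> B a b c d e = test_comb scale L a b c d e"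
proof -
  note hyps = alt lie two three
  have "length (sorted_list_of_multiset m) = 5"
    using size by (metis mset_sorted_list_of_multiset size_mset)
  then obtain p q r s t where xs: "sorted_list_of_multiset m = [p, q, r, s, t]"
    by (auto simp: numeral_eq_Suc length_Suc_conv)
  have m: "m = {#p, q, r, s, t#}"
    using mset_sorted_list_of_multiset[of m] unfolding xs by simp
  have "sorted [p, q, r, s, t]"
    using sorted_sorted_list_of_multiset[of m] unfolding xs .
  then consider
      (triple) "p = q \<and> q = r \<or> q = r \<and> r = s \<or> r = s \<and> s = t"
    | (distinct) "p < q" "q < r" "r < s" "s < t"
    | (pq) "p = q" "q < r" "r < s" "s < t" | (qr) "p < q" "q = r" "r < s" "s < t"
    | (rs) "p < q" "q < r" "r = s" "s < t" | (st) "p < q" "q < r" "r < s" "s = t"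
    | (pq_rs) "p = q" "q < r" "r = s" "s < t" | (pq_st) "p = q" "q < r" "r < s" "s = t"
    | (qr_st) "p < q" "q = r" "r < s" "s = t"
    by (auto simp: le_less)
  then show ?thesis
  proof cases
    case triple
    then have "count m q > 2 \<or> count m r > 2 \<or> count m s > 2" by (auto simp: m)
    then have "B a b c d e = 0" if "{#a, b, c, d, e#} = m" for a b c d e
      using alternating23_count[OF alt, of a b c d e] that by (metis not_less)
    then show ?thesis by (intro exI[of _ "[]"]) (simp add: test_comb_simps)
  next
    case distinct
    show ?thesis
      unfolding m by (intro exI allI impI) (rule span_distinct[OF hyps distinct])
  next
    case pq
    then have m: "m = {#p, p, r, s, t#}"
      by (simp add: m add_mset_commute)
    show ?thesis
      unfolding m using pq
      by (intro exI allI impI) (rule span_one_pair[OF hyps, of p r s t], simp_all)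
  next
    case qr
    then have m: "m = {#q, q, p, s, t#}"
      by (simp add: m add_mset_commute)
    show ?thesis
      unfolding m using qr
      by (intro exI allI impI) (rule span_one_pair[OF hyps, of q p s t], simp_all)
  next
    case rs
    then have m: "m = {#r, r, p, q, t#}"
      by (simp add: m add_mset_commute)
    show ?thesis
      unfolding m using rs
      by (intro exI allI impI) (rule span_one_pair[OF hyps, of r p q t], simp_all)
  next
    case st
    then have m: "m = {#s, s, p, q, r#}"
      by (simp add: m add_mset_commute)
    show ?thesis
      unfolding m using st
      by (intro exI allI impI) (rule span_one_pair[OF hyps, of s p q r], simp_all)
  next
    case pq_rs
    then have m: "m = {#p, p, r, r, t#}"
      by (simp add: m add_mset_commute)
    show ?thesis
      unfolding m using pq_rs
      by (intro exI allI impI) (rule span_two_pairs[OF hyps, of p r t], simp_all)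
  next
    case pq_st
    then have m: "m = {#p, p, s, s, r#}"
      by (simp add: m add_mset_commute)
    show ?thesis
      unfolding m using pq_st
      by (intro exI allI impI) (rule span_two_pairs[OF hyps, of p s r], simp_all)
  next
    case qr_st
    then have m: "m = {#q, q, s, s, p#}"
      by (simp add: m add_mset_commute)
    show ?thesis
      unfolding m using qr_st
      by (intro exI allI impI) (rule span_two_pairs[OF hyps, of q s p], simp_all)
  qed
qed

end


section \<open>Evaluating the defining identities\<close>

context vector_space
begin

lemma eval_poly_superset:
  assumes "finite A" and "Poly_Mapping.keys f \<subseteq> A"
  shows "eval_poly scale \<omega> s f = (\<Sum>w\<in>A. scale (Poly_Mapping.lookup f w) (eval_word \<omega> s w))"
  unfolding eval_poly_def
  by (rule sum.mono_neutral_left) (use assms in \<open>auto simp: in_keys_iff\<close>)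

lemma eval_poly_add:
  "eval_poly scale \<omega> s (f + g) = eval_poly scale \<omega> s f + eval_poly scale \<omega> s g"
proof -
  have "Poly_Mapping.keys (f + g) \<subseteq> Poly_Mapping.keys f \<union> Poly_Mapping.keys g"
    by (rule Poly_Mapping.keys_add)
  then show ?thesis
    by (simp add: eval_poly_superset[of "Poly_Mapping.keys f \<union> Poly_Mapping.keys g"]
        lookup_add scale_left_distrib sum.distrib)
qed

lemma eval_poly_diff:
  "eval_poly scale \<omega> s (f - g) = eval_poly scale \<omega> s f - eval_poly scale \<omega> s g"
  using eval_poly_add[of \<omega> s "f - g" g] by simp

lemma eval_poly_single:
  "eval_poly scale \<omega> s (Poly_Mapping.single w c) = scale c (eval_word \<omega> s w)"
  by (simp add: eval_poly_def)

text \<open>The two adjacent transpositions generate all permutations of the arguments.\<close>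

lemma skew_symmetric_if_identities:
  assumes "\<forall>g \<in> skew_symmetric_identities. is_identity scale \<omega> g"
  shows "\<omega> y x z = - \<omega> x y z" and "\<omega> x z y = - \<omega> x y z"
proof -
  define s where "s i = (if i = 1 then x else if i = 2 then y else z)" for i :: nat
  have *: "eval_poly scale \<omega> s (word_poly (Omega (Var (\<sigma> 1)) (Var (\<sigma> 2)) (Var (\<sigma> 3)))
      - Poly_Mapping.single (Omega (Var 1) (Var 2) (Var 3)) (of_int (sign \<sigma>))) = 0"
    if "\<sigma> permutes {1, 2, 3}" for \<sigma>
    using assms that unfolding skew_symmetric_identities_def is_identity_def by blast
  have "Transposition.transpose 1 2 permutes {1, 2, 3 :: nat}" "Transposition.transpose 2 3 permutes {1, 2, 3 :: nat}"
    by (rule permutes_swap_id; simp)+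
  note this[THEN *]
  then show "\<omega> y x z = - \<omega> x y z" "\<omega> x z y = - \<omega> x y z"
    by (simp_all add: eval_poly_diff eval_poly_single sign_swap_id s_def Transposition.transpose_def
        eq_neg_iff_add_eq_0)
qed

lemma three_lie_if_identity:
  assumes "is_identity scale \<omega> three_lie_identity"
  shows "\<omega> x y (\<omega> u v w) = \<omega> (\<omega> x y u) v w + \<omega> u (\<omega> x y v) w + \<omega> u v (\<omega> x y w)"
proof -
  define s where
    "s i = (if i = 1 then x else if i = 2 then y else if i = 3 then u else if i = 4 then v else w)"
    for i :: nat
  from assms have "eval_poly scale \<omega> s three_lie_identity = 0"
    by (simp add: is_identity_def)
  then show ?thesis
    by (simp add: three_lie_identity_def eval_poly_diff eval_poly_add eval_poly_single s_def)
qed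

end

section \<open>Transfer of identities from the Jacobian algebra to skew-symmetric 3-Lie
  algebras\<close>

context omega_algebra
begin

text \<open>Equal arguments give zero because 2 is invertible; linearity in the last slot carries
  signs and zeros of the inner product outward.\<close>

lemma nested_alternating23:
  assumes two: "(2::'k) \<noteq> 0"
    and skew: "\<And>x y z. \<omega> y x z = - \<omega> x y z" "\<And>x y z. \<omega> x z y = - \<omega> x y z"
  shows "alternating23 (\<lambda>a b c d e. \<omega> (s a) (s b) (\<omega> (s c) (s d) (s e)))"
proof -
  have tf: "v = 0" if "v = - v" for v :: 'u
  proof -
    from that have "v + v = 0" by (simp add: eq_neg_iff_add_eq_0)
    moreover have "v + v = smul 2 v" by (metis one_add_one scale_left_distrib scale_one)
    ultimately show ?thesis using two by simp
  qed
  have eq: "\<omega> x x z = 0" for x z by (rule tf, rule skew)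
  have neg: "\<omega> u v (- w) = - \<omega> u v w" for u v w
    using module_hom.neg[OF linear_3[of u v, folded module_hom_iff_linear]] .
  have zero: "\<omega> u v 0 = 0" for u v
    using module_hom.zero[OF linear_3[of u v, folded module_hom_iff_linear]] .
  show ?thesis
    unfolding alternating23_def
  proof (intro allI conjI)
    fix a b c d e
    show "\<omega> (s b) (s a) (\<omega> (s c) (s d) (s e)) = - \<omega> (s a) (s b) (\<omega> (s c) (s d) (s e))"
      by (rule skew(1))
    show "\<omega> (s a) (s b) (\<omega> (s d) (s c) (s e)) = - \<omega> (s a) (s b) (\<omega> (s c) (s d) (s e))"
      by (simp only: skew(1)[of "s d" "s c"] neg)
    show "\<omega> (s a) (s b) (\<omega> (s c) (s e) (s d)) = - \<omega> (s a) (s b) (\<omega> (s c) (s d) (s e))"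
      by (simp only: skew(2)[of "s c" "s e" "s d"] neg)
  qed (simp_all add: eq zero)
qed

text \<open>Within one multidegree all words expand over the same tests with the same vectors.
  Exchanging the sums leaves the scalar relations obtained from the Jacobian algebra as coefficients
  of these vectors.\<close>

lemma is_identity_if_Jac3_identity:
  fixes f :: "'k omega_poly"
  assumes two: "(2::'k) \<noteq> 0" and three: "(3::'k) \<noteq> 0"
    and deg: "has_omega_degree f 2"
    and id: "is_identity scale3 Jac3 f"
    and skew: "\<And>x y z. \<omega> y x z = - \<omega> x y z" "\<And>x y z. \<omega> x z y = - \<omega> x y z"
    and lie: "\<And>x y u v w. \<omega> x y (\<omega> u v w) =
      \<omega> (\<omega> x y u) v w + \<omega> u (\<omega> x y v) w + \<omega> u v (\<omega> x y w)"
  shows "is_identity smul \<omega> f"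
  unfolding is_identity_def
proof
  fix s :: "nat \<Rightarrow> 'u"
  define W where "W = Poly_Mapping.keys f"
  define k where "k = Poly_Mapping.lookup f"
  have [simp]: "finite W" by (simp add: W_def)
  have "\<forall>w. \<exists>a b c d e. w \<in> W \<longrightarrow> nested w a b c d e"
    using deg nested_exists unfolding has_omega_degree_def W_def by blast
  then obtain a b c d e where nested: "\<And>w. w \<in> W \<Longrightarrow> nested w (a w) (b w) (c w) (d w) (e w)"
    by metis
  define B where "B a b c d e = \<omega> (s a) (s b) (\<omega> (s c) (s d) (s e))" for a b c d e
  have cyclic: "\<omega> x y z = \<omega> y z x" for x y z by (metis skew minus_minus)
  have alt: "alternating23 B"
    unfolding B_def by (rule nested_alternating23[OF two skew])
  \<comment> \<open>Cyclic rotation brings each inner product to the last place without a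
    sign.\<close>
  have lieB: "B a b c d e = B d e a b c + B e c a b d + B c d a b e" for a b c d e
    unfolding B_def lie[of "s a" "s b"]
    using cyclic[of "\<omega> (s a) (s b) (s c)" "s d" "s e"] cyclic[of "s e" "s c" "\<omega> (s a) (s b) (s d)"]
    by simp
  have minors: "(\<Sum>w | w \<in> W \<and> leaves w = m. k w * minors \<alpha> \<beta> \<gamma> (a w) (b w) (c w) (d w) (e w)) = 0"
    for m \<alpha> \<beta> \<gamma>
  proof (rule separate_content[OF two \<open>finite W\<close>])
    fix w i assume "w \<in> W" "k w * minors \<alpha> \<beta> \<gamma> (a w) (b w) (c w) (d w) (e w) \<noteq> 0"
    then show "count (leaves w) i \<le> 2"
      using alternating23_count[OF alternating23_minors] leaves_nested[OF nested]
      by (metis mult_zero_right)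
  next
    fix \<mu> :: "nat \<Rightarrow> 'k"
    have "(\<Sum>w\<in>W. k w * minors \<alpha> \<beta> \<gamma> (a w) (b w) (c w) (d w) (e w) *
        prod_mset (image_mset \<mu> (leaves w))) =
      (\<Sum>w\<in>W. k w * minors (\<lambda>i. \<mu> i * \<alpha> i) (\<lambda>i. \<mu> i * \<beta> i) (\<lambda>i. \<mu> i * \<gamma> i)
        (a w) (b w) (c w) (d w) (e w))"
    proof (intro sum.cong refl)
      fix w assume "w \<in> W"
      \<comment> \<open>\<open>minors\<close> is linear in each of its five columns, so scaling the
        columns by \<mu> pulls out the product of \<mu> over the leaves.\<close>
      show "k w * minors \<alpha> \<beta> \<gamma> (a w) (b w) (c w) (d w) (e w) * prod_mset (image_mset \<mu> (leaves w)) =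
        k w * minors (\<lambda>i. \<mu> i * \<alpha> i) (\<lambda>i. \<mu> i * \<beta> i) (\<lambda>i. \<mu> i * \<gamma> i) (a w) (b w) (c w) (d w) (e w)"
        unfolding leaves_nested[OF nested[OF \<open>w \<in> W\<close>]] minors_def by (simp add: algebra_simps)
    qed
    also have "\<dots> = 0"
      unfolding W_def k_def by (rule sum_minors_eq_0[OF two nested[unfolded W_def] id])
    finally show "(\<Sum>w\<in>W. k w * minors \<alpha> \<beta> \<gamma> (a w) (b w) (c w) (d w) (e w) *
        prod_mset (image_mset \<mu> (leaves w))) = 0" .
  qed
  have comb: "(\<Sum>w | w \<in> W \<and> leaves w = m.
      smul (k w) (test_comb smul L (a w) (b w) (c w) (d w) (e w))) = 0" for m L
  proof (induction L)
    case Nil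
    then show ?case by (simp add: test_comb_simps)
  next
    case (Cons x L)
    obtain \<alpha> \<beta> \<gamma> u where x: "x = ((\<alpha>, \<beta>, \<gamma>), u)" by (metis surj_pair)
    show ?case
      using Cons.IH minors[of \<alpha> \<beta> \<gamma> m]
      by (simp add: x test_comb_simps scale_right_distrib sum.distrib flip: scale_sum_left)
  qed
  have content: "(\<Sum>w | w \<in> W \<and> leaves w = m. smul (k w) (eval_word \<omega> s w)) = 0"
    if "m \<in> leaves ` W" for m
  proof -
    from that have "size m = 5" using leaves_nested[OF nested] by auto
    then obtain L where L: "\<And>a b c d e. {#a, b, c, d, e#} = m \<Longrightarrow> B a b c d e = test_comb smul L a b c d e"
      using test_comb_exists[OF alt lieB two three] by metis
    have "eval_word \<omega> s w = test_comb smul L (a w) (b w) (c w) (d w) (e w)"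
      if "w \<in> W" "leaves w = m" for w
      using eval_word_nested[where \<omega> = \<omega> and s = s, OF cyclic nested[OF that(1)]]
        L leaves_nested[OF nested[OF that(1)]] that(2) by (simp add: B_def)
    then show ?thesis using comb[of L m] by simp
  qed
  have "eval_poly smul \<omega> s f = (\<Sum>w\<in>W. smul (k w) (eval_word \<omega> s w))"
    by (simp add: eval_poly_def W_def k_def)
  also have "\<dots> = (\<Sum>m\<in>leaves ` W. \<Sum>w | w \<in> W \<and> leaves w = m. smul (k w) (eval_word \<omega> s w))"
    by (rule sum.group[symmetric]) simp_all
  also have "\<dots> = 0" using content by (intro sum.neutral) blast
  finally show "eval_poly smul \<omega> s f = 0" .
qed

end

text \<open>Otherwise the characteristic divides \<open>p\<close> without being \<open>p\<close>, so
  it is 1, which is impossible in a field.\<close>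

lemma of_nat_prime_neq_0:
  assumes "prime p" and "CHAR('k::field) \<noteq> p"
  shows "(of_nat p :: 'k) \<noteq> 0"
proof
  assume "(of_nat p :: 'k) = 0"
  then have "CHAR('k) dvd p" by (simp add: of_nat_eq_0_iff_char_dvd)
  with assms have "CHAR('k) = 1" by (metis prime_nat_iff)
  then show False by simp
qed

theorem theorem5p1:
  fixes f :: "'k::field omega_poly"
  assumes "CHAR('k) \<noteq> 2" and "CHAR('k) \<noteq> 3"
    and "has_omega_degree f 2"
    and "is_identity scale3 Jac3 f"
  shows "follows_from TYPE('u::ab_group_add) f
    (insert three_lie_identity skew_symmetric_identities)"
  unfolding follows_from_def
proof (intro allI impI)
  fix smul :: "'k \<Rightarrow> 'u \<Rightarrow> 'u" and \<omega>
  assume "omega_algebra smul \<omega>"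
  then interpret omega_algebra smul \<omega> .
  assume ids: "\<forall>g\<in>insert three_lie_identity skew_symmetric_identities. is_identity smul \<omega> g"
  have numerals: "(2::'k) \<noteq> 0" "(3::'k) \<noteq> 0"
    using of_nat_prime_neq_0[of 2, where ?'k = 'k] of_nat_prime_neq_0[of 3, where ?'k = 'k] assms
    by simp_all
  have skew: "\<forall>g\<in>skew_symmetric_identities. is_identity smul \<omega> g"
    and lie: "is_identity smul \<omega> three_lie_identity"
    using ids by simp_all
  show "is_identity smul \<omega> f"
    by (rule is_identity_if_Jac3_identity[OF numerals assms(3,4)
          skew_symmetric_if_identities[OF skew] three_lie_if_identity[OF lie]])
qed

end
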